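(* Let $b$ be the drift and $L$ the symmetric $\alpha$-stable process described in the context. For any $\beta^+\in(0,1)$ and $\alpha\in(0,2)$ there is a monotonically increasing, continuous function $\delta^+_\cdot:(0,1)\to(0,1)$, $\varepsilon\mapsto\delta^+_\varepsilon$, of polynomial order (i.e. there is $q>0$ with $\lim_{\varepsilon\to0}\ln\delta^+_\varepsilon/\ln\varepsilon=q$), with $\delta^+_\varepsilon\to0$ as $\varepsilon\to0$, such that the first exit time $$\tau^{x,\varepsilon,-}:=\inf\{t>0\ |\ X^{x,\varepsilon}_t\leq\delta^+_\varepsilon\}$$ of the solution $X^{x,\varepsilon}$ of $$X^{x,\varepsilon}_t=x+\int_0^tb(X^{x,\varepsilon}_s)\,ds+\varepsilon L_t,\qquad t\ge0,$$ satisfies, for any function $\varepsilon\mapsto m_\varepsilon\in(0,\infty)$ with $m_\varepsilon\to\infty$ as $\varepsilon\to0$ and $\limsup_{\varepsilon\to0}m_\varepsilon\varepsilon^\alpha<\infty$, $$\lim_{\varepsilon\to0}\ \sup_{x\geq3\delta^+_\varepsilon}\mathbb P\big(\tau^{x,\varepsilon,-}\leq m_\varepsilon\big)=0.$$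
   Context: The drift is $b(x)=B^+|x|^{\beta^+}$ for $x\geq 0$ and $b(x)=-B^-|x|^{\beta^-}$ for $x<0$, with fixed $B^\pm>0$, $\beta^\pm\in(0,1)$. The process $L=(L_t)_{t\ge0}$ on $(\Omega,\mathcal F,\mathbb P)$ is a symmetric pure-jump $\alpha$-stable Lévy process: a Lévy process with characteristic triplet $(0,0,\nu)$ (drift $0$, no Gaussian part, truncation function $\mathbf 1\{|y|\le 1\}$) and Lévy measure $\nu(dy)=c|y|^{-\alpha-1}dy$ on $\mathbb R\setminus\{0\}$, for some $c>0$. Since $b$ is globally Lipschitz on $[\delta,\infty)$ for each $\delta>0$, for an initial value $x>\delta$ the solution $X^{x,\varepsilon}$ is uniquely determined (as a strong local solution) up to the first time it leaves $(\delta,\infty)$, so $\tau^{x,\varepsilon,-}$ is well defined. *)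

theory Defs
  imports "HOL-Probability.Probability"
begin

text \<open>Real-valued processes are functions of type \<^typ>\<open>real \<Rightarrow> 'a \<Rightarrow> real\<close> (time, then sample point);
  only times \<open>t \<ge> 0\<close> are meaningful.\<close>

definition cadlag :: "(real \<Rightarrow> real) \<Rightarrow> bool" where
  "cadlag f \<longleftrightarrow>
     (\<forall>t\<ge>0. (f \<longlongrightarrow> f t) (at_right t)) \<and> (\<forall>t>0. \<exists>l. (f \<longlongrightarrow> l) (at_left t))"

locale levy_process = prob_space M for M :: "'a measure" +
  fixes L :: "real \<Rightarrow> 'a \<Rightarrow> real"
  assumes random_variable_L: "\<And>t. 0 \<le> t \<Longrightarrow> random_variable borel (L t)"
    and L_0: "AE \<omega> in M. L 0 \<omega> = 0"
    and indep_increments: "\<And>(n::nat) t. 0 \<le> t 0 \<Longrightarrow> (\<And>i. i < n \<Longrightarrow> t i < t (Suc i)) \<Longrightarrow>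
          indep_vars (\<lambda>_. borel) (\<lambda>i \<omega>. L (t (Suc i)) \<omega> - L (t i) \<omega>) {..<n}"
    and stationary_increments: "\<And>s t. 0 \<le> s \<Longrightarrow> 0 \<le> t \<Longrightarrow>
          distr M borel (\<lambda>\<omega>. L (s + t) \<omega> - L s \<omega>) = distr M borel (L t)"
    and stochastically_continuous: "\<And>t \<eta>. 0 \<le> t \<Longrightarrow> 0 < \<eta> \<Longrightarrow>
          ((\<lambda>s. prob {\<omega> \<in> space M. \<eta> < \<bar>L s \<omega> - L t \<omega>\<bar>}) \<longlongrightarrow> 0) (at t within {0..})"
    and cadlag_paths: "AE \<omega> in M. cadlag (\<lambda>t. L t \<omega>)"

definition levy_measure :: "real measure \<Rightarrow> bool" where
  "levy_measure \<nu> \<longleftrightarrow> sets \<nu> = sets borel \<and> emeasure \<nu> {0} = 0 \<and>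
     (\<integral>\<^sup>+ y. ennreal (min 1 (y\<^sup>2)) \<partial>\<nu>) < \<infinity>"

text \<open>The Levy-Khintchine exponent of the triplet \<open>(\<gamma>, A, \<nu>)\<close> (drift, Gaussian variance,
  jump measure), with truncation function \<open>1{|y| \<le> 1}\<close>.\<close>

definition levy_exponent :: "real \<Rightarrow> real \<Rightarrow> real measure \<Rightarrow> real \<Rightarrow> complex" where
  "levy_exponent \<gamma> A \<nu> u =
     \<i> * complex_of_real (\<gamma> * u) - complex_of_real (A * u\<^sup>2 / 2)
     + (CLINT y|\<nu>. iexp (u * y) - 1 - \<i> * complex_of_real (u * y * indicator {-1..1} y))"

definition has_levy_triplet ::
    "'a measure \<Rightarrow> (real \<Rightarrow> 'a \<Rightarrow> real) \<Rightarrow> real \<Rightarrow> real \<Rightarrow> real measure \<Rightarrow> bool" where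
  "has_levy_triplet M L \<gamma> A \<nu> \<longleftrightarrow> levy_measure \<nu> \<and>
     (\<forall>t\<ge>0. \<forall>u. char (distr M borel (L t)) u = exp (complex_of_real t * levy_exponent \<gamma> A \<nu> u))"

text \<open>Since \<open>0 powr _ = 0\<close>, this measure on the whole line does not charge the origin.\<close>

definition stable_levy_measure :: "real \<Rightarrow> real \<Rightarrow> real measure" where
  "stable_levy_measure c \<alpha> = density lborel (\<lambda>y. ennreal (c * \<bar>y\<bar> powr (- \<alpha> - 1)))"

definition symmetric_stable_process ::
    "'a measure \<Rightarrow> (real \<Rightarrow> 'a \<Rightarrow> real) \<Rightarrow> real \<Rightarrow> real \<Rightarrow> bool" where
  "symmetric_stable_process M L c \<alpha> \<longleftrightarrow>
     levy_process M L \<and> has_levy_triplet M L 0 0 (stable_levy_measure c \<alpha>)"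

definition drift :: "real \<Rightarrow> real \<Rightarrow> real \<Rightarrow> real \<Rightarrow> real \<Rightarrow> real" where
  "drift Bp Bm \<beta>p \<beta>m x = (if x \<ge> 0 then Bp * \<bar>x\<bar> powr \<beta>p else - Bm * \<bar>x\<bar> powr \<beta>m)"

definition exit_time :: "real \<Rightarrow> (real \<Rightarrow> 'a \<Rightarrow> real) \<Rightarrow> 'a \<Rightarrow> ereal" where
  "exit_time d X \<omega> = Inf {ereal t | t. t > 0 \<and> X t \<omega> \<le> d}"

text \<open>A solution of \<open>X\<^sub>t = x + \<integral>\<^sub>0\<^sup>t b(X\<^sub>s) ds + \<epsilon> L\<^sub>t\<close> up to and including its exit time from
  \<open>(d, \<infinity>)\<close>. After the exit time the path is only required to be cadlag, so solutions on all of
  \<open>[0, \<infinity>)\<close> are included. Right-continuity ensures that \<open>X \<le> d\<close> holds at the exit time itself.\<close>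

definition local_solution :: "'a measure \<Rightarrow> (real \<Rightarrow> real) \<Rightarrow> (real \<Rightarrow> 'a \<Rightarrow> real) \<Rightarrow>
    real \<Rightarrow> real \<Rightarrow> real \<Rightarrow> (real \<Rightarrow> 'a \<Rightarrow> real) \<Rightarrow> bool" where
  "local_solution M b L x \<epsilon> d X \<longleftrightarrow>
     (\<forall>t\<ge>0. X t \<in> borel_measurable (completion M)) \<and>
     (AE \<omega> in M. cadlag (\<lambda>t. X t \<omega>) \<and>
        (\<forall>t\<ge>0. ereal t \<le> exit_time d X \<omega> \<longrightarrow>
           set_integrable lborel {0..t} (\<lambda>s. b (X s \<omega>)) \<and>
           X t \<omega> = x + (LBINT s:{0..t}. b (X s \<omega>)) + \<epsilon> * L t \<omega>))"

text \<open>The set where the exit time is at most \<open>T\<close> is the event that a cadlag process hits a closed set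
  in a time interval; it need not be measurable if the probability space is not complete. Its
  probability is therefore taken with respect to the outer measure, which agrees with the
  probability on every measurable set (and, on the completion, with the completed probability).\<close>

definition exit_prob :: "'a measure \<Rightarrow> real \<Rightarrow> (real \<Rightarrow> 'a \<Rightarrow> real) \<Rightarrow> real \<Rightarrow> ennreal" where
  "exit_prob M d X T = outer_measure_of M {\<omega> \<in> space M. exit_time d X \<omega> \<le> ereal T}"

end

theory Submission
  imports Defs "HOL-Real_Asymp.Real_Asymp"
begin

text \<open>The threshold is \<open>\<delta> \<epsilon> = \<epsilon> powr q\<close> with \<open>q = min 1 \<alpha> / 2\<close>.
As long as the solution stays above \<open>\<delta> = \<delta> \<epsilon>\<close>, its drift is at least \<open>\<gamma> = Bp * \<delta> powr \<beta>p\<close>. A solution that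
starts at \<open>x \<ge> 3 * \<delta>\<close> and falls to \<open>\<delta>\<close> or below for the first time at \<open>t\<close> therefore requires
\<open>2 * \<delta> + \<gamma> * t \<le> \<epsilon> * \<bar>L t\<bar>\<close>: the noise has to cross a line with positive slope
(\<open>exit_prob_le\<close>). This event does not involve \<open>x\<close>, so it is enough to show that its
probability up to a time of order \<open>\<epsilon> powr - \<alpha>\<close> tends to 0.

The tool for this is the maximal inequality
\<open>P (sup over [0, T] of \<bar>L\<bar> > a) \<le> K * T * a powr - \<alpha>\<close> (\<open>symmetric_stable_maximal_inequality\<close>).
Reflection symmetry and scaling of the jump measure show that the Levy exponent is real and at
least \<open>- K * u powr \<alpha>\<close>; the truncation inequality for characteristic functions turns this into a tail
bound for each \<open>L t\<close>, and Ottaviani's inequality along dyadic grids turns the tail bound into one for the supremum.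

On \<open>[0, 1]\<close> \<open>\<bar>L\<bar>\<close> has to exceed \<open>\<delta> / \<epsilon>\<close>, which has probability at most of order
\<open>(\<epsilon> / \<delta>) powr \<alpha>\<close>; this vanishes because \<open>q < 1\<close>. On each dyadic block \<open>[2 ^ k, 2 ^ (k + 1)]\<close> it has to
exceed a multiple of \<open>\<gamma> * 2 ^ k / \<epsilon>\<close>, which has probability at most of order
\<open>(\<epsilon> / \<gamma>) powr \<alpha> * (2 ^ k) powr (1 - \<alpha>)\<close>. Up to the horizon this is at most of order \<open>\<epsilon> powr p\<close> with
\<open>p = \<alpha> * (min 1 \<alpha> - \<beta>p * q)\<close>, which is positive by the choice of \<open>q\<close>. There are only logarithmically many blocks, so
their total contribution vanishes as well (\<open>linear_boundary_crossing_bound\<close>).\<close>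

section \<open>Tails and the stable Levy exponent\<close>

text \<open>The truncation inequality that links tails to the characteristic function near the origin. The
average of \<open>1 - cos (s x)\<close> over \<open>s \<in> [0, 2 / a]\<close> equals \<open>1 - sin v / v\<close> with
\<open>v = 2 x / a\<close>. This is non-negative for every \<open>x\<close> and at least \<open>1 / 2\<close> once \<open>\<bar>x\<bar> \<ge> a\<close>. By Tonelli its
expectation is the average of \<open>1 - Re (char M s)\<close>.\<close>

lemma (in real_distribution) prob_tail_le_char:
  assumes a: "0 < a" and C: "\<And>s. 0 \<le> s \<Longrightarrow> s \<le> 2 / a \<Longrightarrow> 1 - Re (char M s) \<le> C"
  shows "prob {x. a \<le> \<bar>x\<bar>} \<le> 2 * C"
proof -
  have C0: "0 \<le> C"
    using C[of 0] a by (simp add: char_zero)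
  interpret pair_sigma_finite M lborel ..
  have inner: "1 / a \<le> (\<integral>\<^sup>+s. ennreal (1 - cos (s * x)) * indicator {0..2 / a} s \<partial>lborel)"
    if x: "a \<le> \<bar>x\<bar>" for x
  proof -
    have x0: "x \<noteq> 0" using x a by auto
    have "((\<lambda>s. s - sin (s * x) / x) has_real_derivative 1 - cos (s * x)) (at s)" for s
      using x0 by (auto intro!: derivative_eq_intros)
    then have "(\<integral>\<^sup>+s. ennreal (1 - cos (s * x)) * indicator {0..2 / a} s \<partial>lborel)
        = (2 / a - sin (2 / a * x) / x) - (0 - sin (0 * x) / x)"
      using a by (intro nn_integral_FTC_Icc) auto
    moreover have "sin (2 / a * x) / x \<le> 1 / a"
    proof -
      have "sin (2 / a * x) / x \<le> \<bar>sin (2 / a * x)\<bar> / \<bar>x\<bar>"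
        by (metis abs_divide abs_ge_self)
      also have "\<dots> \<le> 1 / a"
        using x a by (intro frac_le) auto
      finally show ?thesis .
    qed
    ultimately show ?thesis
      by (auto intro!: ennreal_leI simp: field_simps)
  qed
  have char_nn: "(\<integral>\<^sup>+x. ennreal (1 - cos (s * x)) \<partial>M) = 1 - Re (char M s)" for s
  proof -
    have cs: "integrable M (\<lambda>x. cos (s * x))"
      by (rule integrable_const_bound[where B=1]) auto
    have "Re (char M s) = (\<integral>x. cos (s * x) \<partial>M)"
      unfolding char_def
      by (subst integral_Re[symmetric]) (auto simp: Re_exp intro!: integrable_iexp)
    moreover have "(\<integral>x. 1 - cos (s * x) \<partial>M) = 1 - (\<integral>x. cos (s * x) \<partial>M)"
      using cs prob_space by simp
    ultimately show ?thesis
      using cs by (subst nn_integral_eq_integral) auto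
  qed
  have "ennreal (1 / a * prob {x. a \<le> \<bar>x\<bar>}) = (\<integral>\<^sup>+x. ennreal (1 / a) * indicator {x. a \<le> \<bar>x\<bar>} x \<partial>M)"
    using a by (subst nn_integral_cmult_indicator) (auto simp: emeasure_eq_measure ennreal_mult[symmetric])
  also have "\<dots> \<le> (\<integral>\<^sup>+x. (\<integral>\<^sup>+s. ennreal (1 - cos (s * x)) * indicator {0..2 / a} s \<partial>lborel) \<partial>M)"
    using inner by (intro nn_integral_mono) (auto split: split_indicator)
  also have "\<dots> = (\<integral>\<^sup>+s. (\<integral>\<^sup>+x. ennreal (1 - cos (s * x)) * indicator {0..2 / a} s \<partial>M) \<partial>lborel)"
    by (subst Fubini') (auto simp: split_beta')
  also have "\<dots> = (\<integral>\<^sup>+s. ennreal (1 - Re (char M s)) * indicator {0..2 / a} s \<partial>lborel)"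
    by (subst nn_integral_multc) (auto simp: char_nn)
  also have "\<dots> \<le> (\<integral>\<^sup>+s. ennreal C * indicator {0..2 / a} s \<partial>lborel)"
    using C by (intro nn_integral_mono) (auto split: split_indicator intro!: ennreal_leI)
  also have "\<dots> = ennreal (C * (2 / a))"
    using a C0 by (subst nn_integral_cmult_indicator) (auto simp: ennreal_mult[symmetric])
  finally have "1 / a * prob {x. a \<le> \<bar>x\<bar>} \<le> C * (2 / a)"
    using a C0 by (subst (asm) ennreal_le_iff) auto
  then show ?thesis
    using a by (simp add: field_simps)
qed

text \<open>The Levy measure is invariant under the reflection \<open>y \<mapsto> - y\<close>, which turns the integrand of the
exponent into its complex conjugate.\<close>

lemma stable_exponent_real:
  assumes "0 \<le> c"
  shows "Im (levy_exponent 0 0 (stable_levy_measure c \<alpha>) u) = 0"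
proof -
  define f where "f = (\<lambda>u y. iexp (u * y) - 1 -
    \<i> * complex_of_real (u * y * indicator {-1..1::real} y))"
  have [measurable]: "f u \<in> borel_measurable borel" for u
    unfolding f_def by measurable
  have ex: "levy_exponent 0 0 (stable_levy_measure c \<alpha>) u = (CLINT y|stable_levy_measure c \<alpha>. f u y)" for u
    by (simp add: levy_exponent_def f_def)
  have "(CLINT y|stable_levy_measure c \<alpha>. f u y)
      = (CLINT y|lborel. (c * \<bar>y\<bar> powr (- \<alpha> - 1)) *\<^sub>R f u y)" for u
    unfolding stable_levy_measure_def using assms by (intro integral_density) auto
  then have "(CLINT y|stable_levy_measure c \<alpha>. f u y)
      = (CLINT y|lborel. (c * \<bar>y\<bar> powr (- \<alpha> - 1)) *\<^sub>R f u (- y))" for u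
    by (subst (asm) lborel_integral_real_affine[where c="-1" and t=0]) auto
  moreover have "(CLINT y|lborel. (c * \<bar>y\<bar> powr (- \<alpha> - 1)) *\<^sub>R f u (- y))
      = (CLINT y|stable_levy_measure c \<alpha>. f u (- y))" for u
    unfolding stable_levy_measure_def using assms by (intro integral_density[symmetric]) auto
  moreover have "f u (- y) = cnj (f u y)" for u y
    unfolding f_def by (auto simp: exp_cnj split: split_indicator)
  ultimately have "(CLINT y|stable_levy_measure c \<alpha>. f u y)
      = cnj (CLINT y|stable_levy_measure c \<alpha>. f u y)" for u
    by simp
  then have "Im (CLINT y|stable_levy_measure c \<alpha>. f u y) = Im (cnj (CLINT y|stable_levy_measure c \<alpha>. f u y))"
    by (rule arg_cong)
  then show ?thesis
    unfolding ex by simp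
qed

text \<open>Self-similarity: dilating space by \<open>u\<close> multiplies the jump intensity by \<open>u powr \<alpha>\<close>. All powers of \<open>\<alpha>\<close>
in the probability estimates below stem from this identity.\<close>

lemma stable_levy_measure_scale:
  assumes "0 < u" and [measurable]: "f \<in> borel_measurable borel"
  shows "(\<integral>\<^sup>+y. f (u * y) \<partial>stable_levy_measure c \<alpha>)
    = ennreal (u powr \<alpha>) * (\<integral>\<^sup>+y. f y \<partial>stable_levy_measure c \<alpha>)"
proof -
  have eq: "u powr \<alpha> * (c * \<bar>u * y\<bar> powr (- \<alpha> - 1)) * u = c * \<bar>y\<bar> powr (- \<alpha> - 1)" for y
  proof -
    have "u powr \<alpha> * u powr (-\<alpha> - 1) * u = 1"
      using assms by (simp add: powr_add[symmetric] powr_minus_divide)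
    then show ?thesis
      using assms by (simp add: abs_mult powr_mult mult_ac)
  qed
  have "(\<integral>\<^sup>+y. f y \<partial>stable_levy_measure c \<alpha>)
      = (\<integral>\<^sup>+y. ennreal (c * \<bar>y\<bar> powr (- \<alpha> - 1)) * f y \<partial>lborel)"
    unfolding stable_levy_measure_def by (subst nn_integral_density) auto
  also have "\<dots> = ennreal u * (\<integral>\<^sup>+y. ennreal (c * \<bar>u * y\<bar> powr (- \<alpha> - 1)) * f (u * y) \<partial>lborel)"
    using assms by (subst nn_integral_real_affine[where c=u and t=0]) auto
  also have "ennreal (u powr \<alpha>) * \<dots>
      = (\<integral>\<^sup>+y. ennreal (u powr \<alpha> * (c * \<bar>u * y\<bar> powr (- \<alpha> - 1)) * u) * f (u * y) \<partial>lborel)"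
    using assms
    by (simp add: nn_integral_cmult[symmetric] ennreal_mult' ennreal_mult'' mult_ac)
  also have "\<dots> = (\<integral>\<^sup>+y. f (u * y) \<partial>stable_levy_measure c \<alpha>)"
    unfolding eq stable_levy_measure_def by (subst nn_integral_density) auto
  finally show ?thesis by simp
qed

text \<open>Because of \<open>1 - cos v \<le> 2 * min 1 (v\<^sup>2)\<close>, the constant can be taken to be twice the integral
that is finite for every Levy measure; scaling then produces the factor \<open>u powr \<alpha>\<close>.\<close>

lemma stable_exponent_bound:
  assumes c: "0 \<le> c" and lm: "levy_measure (stable_levy_measure c \<alpha>)"
  shows "\<exists>K\<ge>0. \<forall>u>0. - K * u powr \<alpha> \<le> Re (levy_exponent 0 0 (stable_levy_measure c \<alpha>) u)"
proof -
  let ?\<nu> = "stable_levy_measure c \<alpha>"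
  define I where "I = (\<integral>\<^sup>+ y. ennreal (min 1 (y\<^sup>2)) \<partial>?\<nu>)"
  define K where "K = 2 * enn2real I"
  have "I < \<infinity>" using lm by (simp add: levy_measure_def I_def)
  then have IK: "2 * I = ennreal K"
    unfolding K_def by (simp add: ennreal_mult)
  have K0: "0 \<le> K" by (simp add: K_def)
  have "- K * u powr \<alpha> \<le> Re (levy_exponent 0 0 ?\<nu> u)" if u: "0 < u" for u
  proof -
    define f where "f = (\<lambda>y. iexp (u * y) - 1 -
      \<i> * complex_of_real (u * y * indicator {-1..1::real} y))"
    have ex: "levy_exponent 0 0 ?\<nu> u = (CLINT y|?\<nu>. f y)"
      by (simp add: levy_exponent_def f_def)
    show ?thesis
    \<comment> \<open>The bound holds trivially for a non-integrable integrand, whose Bochner integral is 0 by convention.\<close>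
    proof (cases "integrable ?\<nu> f")
      case False
      then show ?thesis
        unfolding ex using K0 by (simp add: not_integrable_integral_eq)
    next
      case True
      have Re: "Re (f y) = cos (u * y) - 1" for y
        by (auto simp: f_def Re_exp split: split_indicator)
      have cos: "1 - cos v \<le> 2 * min 1 (v\<^sup>2)" for v :: real
      proof -
        have "1 - v\<^sup>2 / 2 \<le> cos v"
        proof -
          have "(sin (v / 2))\<^sup>2 \<le> (v / 2)\<^sup>2"
            using abs_sin_x_le_abs_x[of "v / 2"] by (subst abs_le_square_iff[symmetric])
          moreover have "cos v = 1 - 2 * (sin (v / 2))\<^sup>2"
            using cos_double_sin[of "v / 2"] by simp
          ultimately show ?thesis by (simp add: power_divide)
        qed
        moreover have "v\<^sup>2 \<ge> 0" by simp
        ultimately show ?thesis using cos_ge_minus_one[of v] by linarith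
      qed
      have "ennreal (norm (\<integral>y. cos (u * y) - 1 \<partial>?\<nu>)) \<le> (\<integral>\<^sup>+y. norm (cos (u * y) - 1) \<partial>?\<nu>)"
        using integrable_Re[OF True] by (intro integral_norm_bound_ennreal) (simp add: Re)
      also have "\<dots> \<le> (\<integral>\<^sup>+y. 2 * ennreal (min 1 ((u * y)\<^sup>2)) \<partial>?\<nu>)"
      proof (intro nn_integral_mono)
        fix y
        have "norm (cos (u * y) - 1) \<le> 2 * min 1 ((u * y)\<^sup>2)"
          using cos[of "u * y"] by simp
        then have "ennreal (norm (cos (u * y) - 1)) \<le> ennreal (2 * min 1 ((u * y)\<^sup>2))"
          by (rule ennreal_leI)
        then show "ennreal (norm (cos (u * y) - 1)) \<le> 2 * ennreal (min 1 ((u * y)\<^sup>2))"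
          by (simp add: ennreal_mult)
      qed
      also have "\<dots> = 2 * (\<integral>\<^sup>+y. ennreal (min 1 ((u * y)\<^sup>2)) \<partial>?\<nu>)"
        by (rule nn_integral_cmult) (simp add: stable_levy_measure_def)
      also have "(\<integral>\<^sup>+y. ennreal (min 1 ((u * y)\<^sup>2)) \<partial>?\<nu>) = ennreal (u powr \<alpha>) * I"
        unfolding I_def by (rule stable_levy_measure_scale[OF u]) simp
      also have "2 * (ennreal (u powr \<alpha>) * I) = 2 * I * ennreal (u powr \<alpha>)"
        by (simp only: mult_ac)
      also have "\<dots> = ennreal (K * u powr \<alpha>)"
        unfolding IK using K0 by (simp add: ennreal_mult)
      finally have "norm (\<integral>y. cos (u * y) - 1 \<partial>?\<nu>) \<le> K * u powr \<alpha>"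
        using K0 by (subst (asm) ennreal_le_iff) auto
      moreover have "Re (levy_exponent 0 0 ?\<nu> u) = (\<integral>y. cos (u * y) - 1 \<partial>?\<nu>)"
        unfolding ex by (subst integral_Re[OF True, symmetric]) (simp add: Re)
      ultimately show ?thesis by simp
    qed
  qed
  with K0 show ?thesis by blast
qed

section \<open>Maximal inequalities\<close>

text \<open>Ottaviani's maximal inequality. Let \<open>k\<close> be the first index at which the partial sum exceeds \<open>2 * a\<close> in
absolute value. The remaining increments are independent of this event, and with probability at
least \<open>1 / 2\<close> they add up to at most \<open>a\<close> in absolute value; then the full sum still exceeds \<open>a\<close>.\<close>

lemma (in prob_space) ottaviani_inequality:
  fixes D :: "nat \<Rightarrow> 'a \<Rightarrow> real"
  assumes indep: "indep_vars (\<lambda>_. borel) D {..<n}"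
    and tail: "\<And>k. k \<le> n \<Longrightarrow> prob {\<omega>\<in>space M. a < \<bar>\<Sum>i\<in>{k..<n}. D i \<omega>\<bar>} \<le> 1 / 2"
  shows "prob {\<omega>\<in>space M. \<exists>k\<le>n. 2 * a < \<bar>\<Sum>i<k. D i \<omega>\<bar>}
    \<le> 2 * prob {\<omega>\<in>space M. a < \<bar>\<Sum>i<n. D i \<omega>\<bar>}"
proof -
  have D[measurable]: "i < n \<Longrightarrow> D i \<in> borel_measurable M" for i
    using indep by (auto simp: indep_vars_def)
  \<comment> \<open>\<open>F k\<close>: the level is first exceeded at step \<open>k\<close>; \<open>G k\<close>: the later increments do not undo this.\<close>
  define F where "F k = {\<omega>\<in>space M. 2 * a < \<bar>\<Sum>i<k. D i \<omega>\<bar> \<and> (\<forall>j<k. \<bar>\<Sum>i<j. D i \<omega>\<bar> \<le> 2 * a)}" for k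
  define G where "G k = {\<omega>\<in>space M. \<bar>\<Sum>i\<in>{k..<n}. D i \<omega>\<bar> \<le> a}" for k
  have S[measurable]: "k \<le> n \<Longrightarrow> (\<lambda>\<omega>. \<Sum>i<k. D i \<omega>) \<in> borel_measurable M" for k
    by (intro borel_measurable_sum) auto
  have R[measurable]: "(\<lambda>\<omega>. \<Sum>i\<in>{k..<n}. D i \<omega>) \<in> borel_measurable M" for k
    by (intro borel_measurable_sum) auto
  have F[measurable]: "F k \<in> events" if "k \<le> n" for k
  proof -
    have "F k = {\<omega>\<in>space M. 2 * a < \<bar>\<Sum>i<k. D i \<omega>\<bar>} \<inter> (space M \<inter> (\<Inter>j\<in>{..<k}. {\<omega>\<in>space M. \<bar>\<Sum>i<j. D i \<omega>\<bar> \<le> 2 * a}))"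
      if "0 < k" using that by (auto simp: F_def)
    moreover have "(\<Inter>j\<in>{..<k}. {\<omega>\<in>space M. \<bar>\<Sum>i<j. D i \<omega>\<bar> \<le> 2 * a}) \<in> events" if "0 < k"
      using that \<open>k \<le> n\<close> by (intro sets.finite_INT) auto
    moreover have "F 0 \<in> events" by (simp add: F_def)
    ultimately show ?thesis using \<open>k \<le> n\<close> by (cases "k = 0") auto
  qed
  have G[measurable]: "G k \<in> events" for k
    unfolding G_def by measurable
  have half: "prob (F k) \<le> 2 * prob (F k \<inter> G k)" if k: "k \<le> n" for k
  proof -
    \<comment> \<open>\<open>U\<close> and \<open>V\<close> express \<open>F k\<close> and \<open>G k\<close> through the disjoint blocks of increments before and after \<open>k\<close>.\<close>
    let ?P1 = "PiM {..<k} (\<lambda>_. borel :: real measure)" and ?P2 = "PiM {k..<n} (\<lambda>_. borel :: real measure)"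
    define U where "U = {f\<in>space ?P1. 2 * a < \<bar>\<Sum>i<k. f i\<bar> \<and> (\<forall>j\<in>{..<k}. \<bar>\<Sum>i<j. f i\<bar> \<le> 2 * a)}"
    define V where "V = {f\<in>space ?P2. \<bar>\<Sum>i\<in>{k..<n}. f i\<bar> \<le> a}"
    have [measurable]: "(\<lambda>f. \<Sum>i<j. f i) \<in> borel_measurable ?P1" if "j \<le> k" for j
      using that by (intro borel_measurable_sum measurable_component_singleton) auto
    have "U \<in> sets ?P1"
      unfolding U_def by measurable
    moreover have "V \<in> sets ?P2"
      unfolding V_def by measurable
    ultimately have "prob ((\<lambda>\<omega>. (restrict (\<lambda>i. D i \<omega>) {..<k}, restrict (\<lambda>i. D i \<omega>) {k..<n})) -` (U \<times> V) \<inter> space M)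
      = prob ((\<lambda>\<omega>. restrict (\<lambda>i. D i \<omega>) {..<k}) -` U \<inter> space M)
        * prob ((\<lambda>\<omega>. restrict (\<lambda>i. D i \<omega>) {k..<n}) -` V \<inter> space M)"
      using k by (intro indep_varD[OF indep_var_restrict[OF indep, of "{..<k}" "{k..<n}"]]) auto
    moreover have "(\<lambda>\<omega>. restrict (\<lambda>i. D i \<omega>) {..<k}) -` U \<inter> space M = F k"
      by (auto simp: U_def F_def space_PiM)
    moreover have "(\<lambda>\<omega>. restrict (\<lambda>i. D i \<omega>) {k..<n}) -` V \<inter> space M = G k"
      by (auto simp: V_def G_def space_PiM)
    moreover have "(\<lambda>\<omega>. (restrict (\<lambda>i. D i \<omega>) {..<k}, restrict (\<lambda>i. D i \<omega>) {k..<n})) -` (U \<times> V) \<inter> space M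
        = ((\<lambda>\<omega>. restrict (\<lambda>i. D i \<omega>) {..<k}) -` U \<inter> space M)
          \<inter> ((\<lambda>\<omega>. restrict (\<lambda>i. D i \<omega>) {k..<n}) -` V \<inter> space M)"
      by auto
    ultimately have "prob (F k \<inter> G k) = prob (F k) * prob (G k)"
      by simp
    moreover have "1 / 2 \<le> prob (G k)"
    proof -
      have "prob (space M - {\<omega>\<in>space M. a < \<bar>\<Sum>i\<in>{k..<n}. D i \<omega>\<bar>}) \<ge> 1 / 2"
        using tail[OF k] by (subst prob_compl) auto
      also have "space M - {\<omega>\<in>space M. a < \<bar>\<Sum>i\<in>{k..<n}. D i \<omega>\<bar>} = G k"
        by (auto simp: G_def)
      finally show ?thesis .
    qed
    ultimately show ?thesis
      using mult_left_mono[of "1/2" "prob (G k)" "prob (F k)"] by simp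
  qed
  have disj: "disjoint_family_on F {..n}"
    by (auto simp: disjoint_family_on_def F_def) (metis linorder_neqE_nat not_less)
  then have disj': "disjoint_family_on (\<lambda>k. F k \<inter> G k) {..n}"
    by (auto simp: disjoint_family_on_def)
  have "{\<omega>\<in>space M. \<exists>k\<le>n. 2 * a < \<bar>\<Sum>i<k. D i \<omega>\<bar>} = (\<Union>k\<in>{..n}. F k)"
  proof safe
    fix \<omega> k assume \<omega>: "\<omega> \<in> space M" and k: "k \<le> n" "2 * a < \<bar>\<Sum>i<k. D i \<omega>\<bar>"
    let ?Q = "\<lambda>k. 2 * a < \<bar>\<Sum>i<k. D i \<omega>\<bar>"
    have "?Q (LEAST k. ?Q k)" "(LEAST k. ?Q k) \<le> k" "\<forall>j<(LEAST k. ?Q k). \<not> ?Q j"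
      using k by (auto intro: LeastI Least_le dest: not_less_Least)
    then have "\<omega> \<in> F (LEAST k. ?Q k)" "(LEAST k. ?Q k) \<le> n"
      using \<omega> k unfolding F_def by (auto simp: not_less)
    then show "\<omega> \<in> (\<Union>k\<in>{..n}. F k)" by blast
  qed (auto simp: F_def)
  then have "prob {\<omega>\<in>space M. \<exists>k\<le>n. 2 * a < \<bar>\<Sum>i<k. D i \<omega>\<bar>} = (\<Sum>k\<le>n. prob (F k))"
    using disj by (subst finite_measure_finite_Union[symmetric]) auto
  also have "\<dots> \<le> (\<Sum>k\<le>n. 2 * prob (F k \<inter> G k))"
    using half by (intro sum_mono) auto
  also have "\<dots> = 2 * prob (\<Union>k\<in>{..n}. F k \<inter> G k)"
    using disj' by (subst finite_measure_finite_Union) (auto simp: sum_distrib_left)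
  also have "\<dots> \<le> 2 * prob {\<omega>\<in>space M. a < \<bar>\<Sum>i<n. D i \<omega>\<bar>}"
  proof -
    have "F k \<inter> G k \<subseteq> {\<omega>\<in>space M. a < \<bar>\<Sum>i<n. D i \<omega>\<bar>}" if "k \<le> n" for k
    proof
      fix \<omega> assume "\<omega> \<in> F k \<inter> G k"
      moreover have "(\<Sum>i<n. D i \<omega>) = (\<Sum>i<k. D i \<omega>) + (\<Sum>i\<in>{k..<n}. D i \<omega>)"
        using sum.atLeastLessThan_concat[of 0 k n "\<lambda>i. D i \<omega>"] that by (simp add: atLeast0LessThan)
      ultimately show "\<omega> \<in> {\<omega>\<in>space M. a < \<bar>\<Sum>i<n. D i \<omega>\<bar>}"
        by (auto simp: F_def G_def)
    qed
    then show ?thesis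
      by (intro mult_left_mono finite_measure_mono) auto
  qed
  finally show ?thesis .
qed

text \<open>Exit probabilities are outer measures of sets that need not be measurable. Finite subadditivity is
the rule that is used to combine them.\<close>

lemma outer_measure_of_Un_le:
  "outer_measure_of M (A \<union> B) \<le> outer_measure_of M A + outer_measure_of M B"
proof (cases "A \<subseteq> space M \<and> B \<subseteq> space M")
  case True
  then obtain E F where "E \<in> sets M" "A \<subseteq> E" "outer_measure_of M A = emeasure M E"
      "F \<in> sets M" "B \<subseteq> F" "outer_measure_of M B = emeasure M F"
    using outer_measure_of_attain by metis
  then have "outer_measure_of M (A \<union> B) \<le> outer_measure_of M (E \<union> F)"
    by (intro outer_measure_of_mono) auto
  also have "\<dots> = emeasure M (E \<union> F)"
    using \<open>E \<in> sets M\<close> \<open>F \<in> sets M\<close> by (intro outer_measure_of_eq) auto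
  also have "\<dots> \<le> emeasure M E + emeasure M F"
    using \<open>E \<in> sets M\<close> \<open>F \<in> sets M\<close> by (rule emeasure_subadditive)
  finally show ?thesis
    using \<open>outer_measure_of M A = _\<close> \<open>outer_measure_of M B = _\<close> by simp
next
  case False
  then have "{S \<in> sets M. A \<subseteq> S} = {} \<or> {S \<in> sets M. B \<subseteq> S} = {}"
    by (auto dest: sets.sets_into_space)
  then have "outer_measure_of M A = \<top> \<or> outer_measure_of M B = \<top>"
    unfolding outer_measure_of_def by (elim disjE) auto
  then show ?thesis
    by auto
qed

lemma outer_measure_of_UN_lessThan_le:
  fixes N :: nat
  shows "outer_measure_of M (\<Union>k<N. A k) \<le> (\<Sum>k<N. outer_measure_of M (A k))"
proof (induction N)
  case (Suc N)
  have "outer_measure_of M (\<Union>k<Suc N. A k) \<le> outer_measure_of M (\<Union>k<N. A k) + outer_measure_of M (A N)"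
    using outer_measure_of_Un_le[of M "\<Union>k<N. A k" "A N"] by (simp add: lessThan_Suc Un_commute)
  also have "\<dots> \<le> (\<Sum>k<Suc N. outer_measure_of M (A k))"
    using Suc by (simp add: add_right_mono)
  finally show ?case .
qed simp

text \<open>Right-continuity carries a strict inequality at time \<open>t\<close> to the times shortly after \<open>t\<close>, hence to a
grid point; the endpoint \<open>T\<close>, which has no such times in the interval, is a grid point itself.\<close>

lemma cadlag_exceeds_on_dyadic_grid:
  assumes f: "cadlag f" and t: "0 \<le> t" "t \<le> T" and a: "a < \<bar>f t\<bar>"
  shows "\<exists>n k. k \<le> 2 ^ n \<and> a < \<bar>f (T * real k / 2 ^ n)\<bar>"
proof (cases "t = T")
  case True
  then have "1 \<le> (2::nat) ^ 0 \<and> a < \<bar>f (T * real 1 / 2 ^ 0)\<bar>"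
    using a by simp
  then show ?thesis by blast
next
  case False
  with t have tT: "t < T" by simp
  have "(f \<longlongrightarrow> f t) (at_right t)" using f t by (simp add: cadlag_def)
  then have "\<forall>\<^sub>F s in at_right t. a < \<bar>f s\<bar>"
    using a by (intro order_tendstoD(1)[OF tendsto_rabs])
  then obtain b where b: "t < b" "\<And>s. t < s \<Longrightarrow> s < b \<Longrightarrow> a < \<bar>f s\<bar>"
    unfolding eventually_at_right_field by blast
  define \<eta> where "\<eta> = min b T - t"
  have \<eta>: "0 < \<eta>" using b tT by (simp add: \<eta>_def)
  obtain n where n: "T / \<eta> < 2 ^ n"
    using real_arch_pow[of 2 "T / \<eta>"] by auto
  \<comment> \<open>The first grid point strictly after \<open>t\<close>.\<close>
  define k where "k = nat \<lfloor>t * 2 ^ n / T\<rfloor> + 1"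
  have "0 \<le> t * 2 ^ n / T" using t tT by simp
  then have k: "t * 2 ^ n / T < real k" "real k \<le> t * 2 ^ n / T + 1"
    unfolding k_def by linarith+
  have T: "0 < T" using t tT by simp
  have "t < T * real k / 2 ^ n"
    using k(1) T by (simp add: field_simps)
  moreover have "T * real k / 2 ^ n \<le> t + T / 2 ^ n"
    using k(2) T by (simp add: field_simps)
  moreover have "T / 2 ^ n < \<eta>"
    using n \<eta> by (simp add: field_simps)
  ultimately have s: "t < T * real k / 2 ^ n" "T * real k / 2 ^ n < min b T"
    unfolding \<eta>_def by linarith+
  then have "T * real k < T * 2 ^ n"
    by (simp add: field_simps)
  then have "real k < real (2 ^ n)"
    using T by simp
  then have "k \<le> 2 ^ n"
    by (simp only: of_nat_less_iff less_imp_le)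
  with s b show ?thesis by auto
qed

lemma (in levy_process) prob_increment_eq:
  assumes "0 \<le> s" "s \<le> t"
  shows "prob {\<omega>\<in>space M. a < \<bar>L t \<omega> - L s \<omega>\<bar>} = prob {\<omega>\<in>space M. a < \<bar>L (t - s) \<omega>\<bar>}"
proof -
  have [measurable]: "L t \<in> borel_measurable M" "L s \<in> borel_measurable M" "L (t - s) \<in> borel_measurable M"
    using assms by (auto intro: random_variable_L)
  have "distr M borel (\<lambda>\<omega>. L t \<omega> - L s \<omega>) = distr M borel (L (t - s))"
    using stationary_increments[of s "t - s"] assms by simp
  then have "measure (distr M borel (\<lambda>\<omega>. L t \<omega> - L s \<omega>)) {x. a < \<bar>x\<bar>}
      = measure (distr M borel (L (t - s))) {x. a < \<bar>x\<bar>}"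
    by simp
  then show ?thesis
    by (simp add: measure_distr vimage_def Int_def conj_commute)
qed

text \<open>Ottaviani's inequality applied to the increments along the dyadic grids. The grids are nested, so the
bound passes to their union by monotone continuity, and that union sees every excursion of a cadlag
path. If \<open>p > 1 / 2\<close> the bound exceeds 1.\<close>

lemma (in levy_process) maximal_inequality:
  assumes T: "0 < T"
    and tail: "\<And>t. 0 \<le> t \<Longrightarrow> t \<le> T \<Longrightarrow> prob {\<omega>\<in>space M. a < \<bar>L t \<omega>\<bar>} \<le> p"
  shows "outer_measure_of M {\<omega>\<in>space M. \<exists>t\<in>{0..T}. 2 * a < \<bar>L t \<omega>\<bar>} \<le> ennreal (2 * p)"
proof (cases "p \<le> 1 / 2")
  case False
  have "outer_measure_of M {\<omega>\<in>space M. \<exists>t\<in>{0..T}. 2 * a < \<bar>L t \<omega>\<bar>} \<le> outer_measure_of M (space M)"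
    by (rule outer_measure_of_mono) auto
  also have "\<dots> \<le> ennreal (2 * p)"
    using False by (simp add: emeasure_space_1)
  finally show ?thesis .
next
  case True
  define D where "D n i \<omega> = L (T * real (Suc i) / 2 ^ n) \<omega> - L (T * real i / 2 ^ n) \<omega>" for n i \<omega>
  define E where "E n = {\<omega>\<in>space M. \<exists>k\<le>2 ^ n. 2 * a < \<bar>\<Sum>i<k. D n i \<omega>\<bar>}" for n
  have tele: "(\<Sum>i\<in>{j..<k}. D n i \<omega>) = L (T * real k / 2 ^ n) \<omega> - L (T * real j / 2 ^ n) \<omega>"
    if "j \<le> k" for j k n \<omega>
    unfolding D_def using sum_Suc_diff'[OF that, of "\<lambda>i. L (T * real i / 2 ^ n) \<omega>"] by simp
  have tele0: "(\<Sum>i<k. D n i \<omega>) = L (T * real k / 2 ^ n) \<omega> - L 0 \<omega>" for k n \<omega>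
    using tele[of 0 k] by (simp add: atLeast0LessThan)
  have [measurable]: "L t \<in> borel_measurable M" if "0 \<le> t" for t
    using that by (rule random_variable_L)
  have [measurable]: "L (T * real k / 2 ^ n) \<in> borel_measurable M" "L 0 \<in> borel_measurable M" for k n
    using T by (auto intro: random_variable_L)
  have E_sets[measurable]: "E n \<in> events" for n
    unfolding E_def tele0 by measurable
  have E_le: "emeasure M (E n) \<le> ennreal (2 * p)" for n
  proof -
    have ind: "indep_vars (\<lambda>_. borel) (D n) {..<2 ^ n}"
      unfolding D_def using T by (intro indep_increments) (auto simp: divide_simps)
    have le: "prob {\<omega>\<in>space M. a < \<bar>\<Sum>i\<in>{k..<2 ^ n}. D n i \<omega>\<bar>} \<le> p" if k: "k \<le> 2 ^ n" for k
    proof -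
      have "real k \<le> real (2 ^ n)" using k by (simp only: of_nat_le_iff)
      then have "T * real k / 2 ^ n \<le> T" "0 \<le> T * real k / 2 ^ n"
        using T by (simp_all add: field_simps)
      then show ?thesis
        using prob_increment_eq[of "T * real k / 2 ^ n" T a] tail[of "T - T * real k / 2 ^ n"] k
        by (simp add: tele)
    qed
    have "prob (E n) \<le> 2 * prob {\<omega>\<in>space M. a < \<bar>\<Sum>i<2 ^ n. D n i \<omega>\<bar>}"
      unfolding E_def by (rule ottaviani_inequality[OF ind], rule order_trans[OF le True])
    also have "\<dots> \<le> 2 * p"
      using le[of 0] by (simp add: atLeast0LessThan)
    finally show ?thesis
      by (simp add: emeasure_eq_measure ennreal_leI)
  qed
  have "incseq E"
  proof (rule incseq_SucI, rule subsetI)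
    fix n \<omega> assume "\<omega> \<in> E n"
    then obtain k where k: "\<omega> \<in> space M" "k \<le> 2 ^ n" "2 * a < \<bar>L (T * real k / 2 ^ n) \<omega> - L 0 \<omega>\<bar>"
      by (auto simp: E_def tele0)
    then have "2 * k \<le> 2 ^ Suc n" "2 * a < \<bar>L (T * real (2 * k) / 2 ^ Suc n) \<omega> - L 0 \<omega>\<bar>"
      by auto
    then show "\<omega> \<in> E (Suc n)"
      unfolding E_def tele0 using k(1) by blast
  qed
  then have UE: "emeasure M (\<Union>n. E n) \<le> ennreal (2 * p)"
    using E_le by (subst SUP_emeasure_incseq[symmetric]) (auto intro!: SUP_least)
  obtain N where N: "N \<in> null_sets M"
      "\<And>\<omega>. \<omega> \<in> space M - N \<Longrightarrow> L 0 \<omega> = 0 \<and> cadlag (\<lambda>t. L t \<omega>)"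
    using AE_conjI[OF L_0 cadlag_paths] by (auto elim!: AE_E3)
  have "{\<omega>\<in>space M. \<exists>t\<in>{0..T}. 2 * a < \<bar>L t \<omega>\<bar>} \<subseteq> N \<union> (\<Union>n. E n)"
  proof safe
    fix \<omega> t assume \<omega>: "\<omega> \<in> space M" and t: "t \<in> {0..T}" "2 * a < \<bar>L t \<omega>\<bar>"
      and "\<omega> \<notin> (\<Union>n. E n)"
    show "\<omega> \<in> N"
    proof (rule ccontr)
      assume "\<omega> \<notin> N"
      then have "L 0 \<omega> = 0" "cadlag (\<lambda>t. L t \<omega>)" using N(2) \<omega> by auto
      then obtain n k where "k \<le> 2 ^ n" "2 * a < \<bar>L (T * real k / 2 ^ n) \<omega>\<bar>"
        using cadlag_exceeds_on_dyadic_grid[of "\<lambda>t. L t \<omega>" t T "2 * a"] t by auto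
      then have "\<omega> \<in> E n"
        unfolding E_def tele0 using \<omega> \<open>L 0 \<omega> = 0\<close> by auto
      with \<open>\<omega> \<notin> (\<Union>n. E n)\<close> show False by blast
    qed
  qed
  then have "outer_measure_of M {\<omega>\<in>space M. \<exists>t\<in>{0..T}. 2 * a < \<bar>L t \<omega>\<bar>}
      \<le> outer_measure_of M (N \<union> (\<Union>n. E n))"
    by (rule outer_measure_of_mono)
  also have "\<dots> = emeasure M ((\<Union>n. E n) \<union> N)"
    using N by (subst outer_measure_of_eq) (auto simp: Un_commute)
  also have "\<dots> = emeasure M (\<Union>n. E n)"
    using N by (intro emeasure_Un_null_set) auto
  finally show ?thesis using UE by simp
qed

text \<open>Up to constants, the supremum over \<open>[0, T]\<close> has the tail \<open>T * a powr - \<alpha>\<close> expected of the largest jump. Since the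
exponent \<open>\<psi>\<close> is real, \<open>1 - Re (char s) = 1 - exp (t * \<psi> s) \<le> - t * \<psi> s\<close>, which is of order
\<open>t * s powr \<alpha>\<close>; the truncation inequality evaluates this at \<open>s\<close> of order \<open>1 / a\<close>.\<close>

lemma symmetric_stable_maximal_inequality:
  assumes c: "0 \<le> c" and \<alpha>: "0 < \<alpha>" and L: "symmetric_stable_process M L c \<alpha>"
  shows "\<exists>K\<ge>0. \<forall>T>0. \<forall>a>0.
    outer_measure_of M {\<omega>\<in>space M. \<exists>t\<in>{0..T}. a < \<bar>L t \<omega>\<bar>} \<le> ennreal (K * T * a powr - \<alpha>)"
proof -
  interpret levy_process M L using L by (simp add: symmetric_stable_process_def)
  let ?\<psi> = "levy_exponent 0 0 (stable_levy_measure c \<alpha>)"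
  have lm: "levy_measure (stable_levy_measure c \<alpha>)"
    and char: "\<And>t u. 0 \<le> t \<Longrightarrow> char (distr M borel (L t)) u = exp (complex_of_real t * ?\<psi> u)"
    using L by (auto simp: symmetric_stable_process_def has_levy_triplet_def)
  obtain K where K: "0 \<le> K" "\<And>u. 0 < u \<Longrightarrow> - K * u powr \<alpha> \<le> Re (?\<psi> u)"
    using stable_exponent_bound[OF c lm] by blast
  have Im: "Im (?\<psi> u) = 0" for u
    using stable_exponent_real[OF c] .
  define K' where "K' = 4 * K * 4 powr \<alpha>"
  have "outer_measure_of M {\<omega>\<in>space M. \<exists>t\<in>{0..T}. a < \<bar>L t \<omega>\<bar>} \<le> ennreal (K' * T * a powr - \<alpha>)"
    if T: "0 < T" and a: "0 < a" for T a
  proof -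
    have tail: "prob {\<omega>\<in>space M. a / 2 < \<bar>L t \<omega>\<bar>} \<le> 2 * (T * K * (4 / a) powr \<alpha>)"
      if t: "0 \<le> t" "t \<le> T" for t
    proof -
      have [measurable]: "L t \<in> borel_measurable M" using t by (intro random_variable_L)
      interpret D: real_distribution "distr M borel (L t)"
        by (rule real_distribution_distr) simp
      have "1 - Re (char (distr M borel (L t)) s) \<le> T * K * (4 / a) powr \<alpha>"
        if s: "0 \<le> s" "s \<le> 2 / (a / 2)" for s
      proof (cases "s = 0")
        case True
        then show ?thesis using T K by (simp add: D.char_zero)
      next
        case False
        have "1 - Re (char (distr M borel (L t)) s) = 1 - exp (t * Re (?\<psi> s))"
          using t by (simp add: char Re_exp Im)
        also have "\<dots> \<le> - (t * Re (?\<psi> s))"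
          using exp_ge_add_one_self[of "t * Re (?\<psi> s)"] by linarith
        also have "\<dots> \<le> t * (K * s powr \<alpha>)"
          using K(2)[of s] s False t mult_left_mono[of "- Re (?\<psi> s)" "K * s powr \<alpha>" t] by simp
        also have "\<dots> \<le> T * (K * (4 / a) powr \<alpha>)"
          using t s \<alpha> K T by (intro mult_mono powr_mono2) auto
        finally show ?thesis by (simp add: mult_ac)
      qed
      then have "D.prob {x. a / 2 \<le> \<bar>x\<bar>} \<le> 2 * (T * K * (4 / a) powr \<alpha>)"
        using a by (intro D.prob_tail_le_char) auto
      also have "D.prob {x. a / 2 \<le> \<bar>x\<bar>} = prob {\<omega>\<in>space M. a / 2 \<le> \<bar>L t \<omega>\<bar>}"
        by (subst measure_distr) (auto intro!: arg_cong[where f=prob])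
      finally have "prob {\<omega>\<in>space M. a / 2 \<le> \<bar>L t \<omega>\<bar>} \<le> 2 * (T * K * (4 / a) powr \<alpha>)" .
      moreover have "prob {\<omega>\<in>space M. a / 2 < \<bar>L t \<omega>\<bar>} \<le> prob {\<omega>\<in>space M. a / 2 \<le> \<bar>L t \<omega>\<bar>}"
        by (intro finite_measure_mono) auto
      ultimately show ?thesis by simp
    qed
    have "2 * (2 * (T * K * (4 / a) powr \<alpha>)) = K' * T * a powr - \<alpha>"
      using a by (simp add: K'_def powr_divide powr_minus field_simps)
    with maximal_inequality[OF T tail] show ?thesis
      by (simp only:) simp
  qed
  moreover have "0 \<le> K'" using K by (simp add: K'_def)
  ultimately show ?thesis by blast
qed

section \<open>Noise against a linear boundary\<close>

text \<open>The times up to \<open>2 ^ N\<close> are cut into \<open>[0, 1]\<close> and the dyadic blocks \<open>[2 ^ k, 2 ^ Suc k]\<close>. On a block the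
line is at least \<open>g * 2 ^ k\<close>, so the maximal inequality bounds the crossing probability by a multiple
of \<open>2 ^ k * (g * 2 ^ k) powr - \<alpha> = g powr - \<alpha> * (2 ^ k) powr (1 - \<alpha>)\<close>. For \<open>\<alpha> \<ge> 1\<close> these powers of two are
bounded by 1, for \<open>\<alpha> < 1\<close> by the one that belongs to the horizon; \<open>max 0 (1 - \<alpha>)\<close> covers
both cases at the price of the factor \<open>N\<close>. The levels are halved because the maximal inequality
concerns strict exceedance.\<close>

lemma linear_boundary_crossing_bound:
  fixes L :: "real \<Rightarrow> 'a \<Rightarrow> real"
  assumes K: "0 \<le> K" and max: "\<And>T a. 0 < T \<Longrightarrow> 0 < a \<Longrightarrow>
      outer_measure_of M {\<omega>\<in>space M. \<exists>t\<in>{0..T}. a < \<bar>L t \<omega>\<bar>} \<le> ennreal (K * T * a powr - \<alpha>)"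
    and h: "0 < h" and g: "0 < g"
  shows "outer_measure_of M {\<omega>\<in>space M. \<exists>t\<in>{0..2 ^ N}. h + g * t \<le> \<bar>L t \<omega>\<bar>}
    \<le> ennreal (K * ((h / 2) powr - \<alpha> + 2 * (g / 2) powr - \<alpha> * real N * (2 ^ N) powr max 0 (1 - \<alpha>)))"
proof -
  define A where "A = {\<omega>\<in>space M. \<exists>t\<in>{0..1}. h / 2 < \<bar>L t \<omega>\<bar>}"
  define B where "B k = {\<omega>\<in>space M. \<exists>t\<in>{0..2 ^ Suc k}. g * 2 ^ k / 2 < \<bar>L t \<omega>\<bar>}" for k
  define Q where "Q = K * (2 * (g / 2) powr - \<alpha> * (2 ^ N) powr max 0 (1 - \<alpha>))"
  have "{\<omega>\<in>space M. \<exists>t\<in>{0..2 ^ N}. h + g * t \<le> \<bar>L t \<omega>\<bar>} \<subseteq> A \<union> (\<Union>k<N. B k)"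
  proof safe
    fix \<omega> t assume \<omega>: "\<omega> \<in> space M" and t: "t \<in> {0..2 ^ N}" "h + g * t \<le> \<bar>L t \<omega>\<bar>"
      and nB: "\<omega> \<notin> (\<Union>k<N. B k)"
    have "t \<le> 1"
    proof (rule ccontr)
      assume "\<not> t \<le> 1"
      define k where "k = (LEAST k. t \<le> 2 ^ Suc k)"
      have "N \<noteq> 0" using t \<open>\<not> t \<le> 1\<close> by (cases N) auto
      then have "t \<le> 2 ^ Suc (N - 1)" using t by simp
      then have k: "t \<le> 2 ^ Suc k" "k \<le> N - 1"
        unfolding k_def by (rule LeastI, rule Least_le)
      have "2 ^ k \<le> t"
      proof (cases k)
        case 0 then show ?thesis using \<open>\<not> t \<le> 1\<close> by simp
      next
        case (Suc j)
        then have "\<not> t \<le> 2 ^ Suc j"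
          using not_less_Least[of j "\<lambda>k. t \<le> 2 ^ Suc k"] by (simp add: k_def)
        then show ?thesis using Suc by simp
      qed
      then have "g * 2 ^ k \<le> g * t" using g by simp
      moreover have "0 < g * 2 ^ k" using g by simp
      ultimately have "g * 2 ^ k / 2 < \<bar>L t \<omega>\<bar>" using t h by linarith
      then have "\<omega> \<in> B k" using \<omega> t k by (auto simp: B_def)
      then show False using nB k \<open>N \<noteq> 0\<close> by auto
    qed
    moreover have "0 \<le> g * t" using g t by simp
    ultimately show "\<omega> \<in> A" using \<omega> t h by (auto simp: A_def intro!: bexI[of _ t])
  qed
  then have "outer_measure_of M {\<omega>\<in>space M. \<exists>t\<in>{0..2 ^ N}. h + g * t \<le> \<bar>L t \<omega>\<bar>}
      \<le> outer_measure_of M (A \<union> (\<Union>k<N. B k))"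
    by (rule outer_measure_of_mono)
  also have "\<dots> \<le> outer_measure_of M A + (\<Sum>k<N. outer_measure_of M (B k))"
    using outer_measure_of_Un_le[of M A "\<Union>k<N. B k"] outer_measure_of_UN_lessThan_le[of M B N]
    by (meson add_left_mono order_trans)
  also have "\<dots> \<le> ennreal (K * (h / 2) powr - \<alpha>) + (\<Sum>k<N. ennreal Q)"
  proof (intro add_mono sum_mono)
    show "outer_measure_of M A \<le> ennreal (K * (h / 2) powr - \<alpha>)"
      unfolding A_def using max[of 1 "h / 2"] h by simp
    fix k assume "k \<in> {..<N}"
    have "outer_measure_of M (B k) \<le> ennreal (K * 2 ^ Suc k * (g * 2 ^ k / 2) powr - \<alpha>)"
      unfolding B_def using g by (intro max) auto
    also have "K * 2 ^ Suc k * (g * 2 ^ k / 2) powr - \<alpha> = K * (2 * (g / 2) powr - \<alpha> * (2 ^ k) powr (1 - \<alpha>))"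
    proof -
      have "(g * 2 ^ k / 2) powr - \<alpha> = (g / 2) powr - \<alpha> * (2 ^ k) powr - \<alpha>"
        using g powr_mult[of "g / 2" "2 ^ k" "- \<alpha>"] by simp
      moreover have "(2 ^ k) powr (1 - \<alpha>) = 2 ^ k * (2 ^ k :: real) powr - \<alpha>"
        using powr_add[of "2 ^ k :: real" 1 "- \<alpha>"] by simp
      ultimately show ?thesis by simp
    qed
    also have "\<dots> \<le> Q"
    proof -
      have "(2 ^ k :: real) powr (1 - \<alpha>) \<le> (2 ^ k) powr max 0 (1 - \<alpha>)"
        by (intro powr_mono) auto
      also have "\<dots> \<le> (2 ^ N) powr max 0 (1 - \<alpha>)"
        using \<open>k \<in> _\<close> by (intro powr_mono2) auto
      finally show ?thesis
        unfolding Q_def using K g by (intro mult_left_mono) auto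
    qed
    finally show "outer_measure_of M (B k) \<le> ennreal Q"
      by (auto intro: ennreal_leI)
  qed
  also have "\<dots> = ennreal (K * (h / 2) powr - \<alpha>) + ennreal (real N * Q)"
    using K by (simp add: Q_def ennreal_mult'[symmetric] ennreal_of_nat_eq_real_of_nat)
  also have "\<dots> = ennreal (K * (h / 2) powr - \<alpha> + real N * Q)"
    using K by (intro ennreal_plus[symmetric]) (auto simp: Q_def)
  finally show ?thesis
    by (simp add: Q_def algebra_simps)
qed

text \<open>Before the exit the path lies above \<open>d\<close>, so the drift has contributed at least \<open>g * t\<close> by time \<open>t\<close>. At the exit
time the path is at most \<open>d\<close> by right-continuity, and only the noise can have compensated both the drift and
the initial distance \<open>x - d\<close>.\<close>

lemma exit_forces_noise_above_line:
  assumes cad: "cadlag (\<lambda>t. X t \<omega>)" and ex: "exit_time d X \<omega> \<le> ereal T"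
    and sol: "\<And>t. 0 \<le> t \<Longrightarrow> ereal t \<le> exit_time d X \<omega> \<Longrightarrow>
      set_integrable lborel {0..t} (\<lambda>s. b (X s \<omega>)) \<and>
      X t \<omega> = x + (LBINT s:{0..t}. b (X s \<omega>)) + Z t"
    and b: "\<And>y. d < y \<Longrightarrow> g \<le> b y"
  shows "\<exists>t\<in>{0..T}. x - d + g * t \<le> \<bar>Z t\<bar>"
proof -
  define S where "S = {t. 0 < t \<and> X t \<omega> \<le> d}"
  have exS: "exit_time d X \<omega> = Inf (ereal ` S)"
    by (auto simp: exit_time_def S_def intro!: arg_cong[where f=Inf])
  have "S \<noteq> {}" using ex by (auto simp: exS top_ereal_def)
  moreover have bdd: "bdd_below S" by (auto simp: S_def intro!: bdd_belowI[of _ 0])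
  ultimately have ex_eq: "exit_time d X \<omega> = ereal (Inf S)"
    unfolding exS using ereal_Inf'[of S] by simp
  define \<tau> where "\<tau> = Inf S"
  have \<tau>: "0 \<le> \<tau>" "\<tau> \<le> T"
    using \<open>S \<noteq> {}\<close> ex ex_eq by (auto simp: \<tau>_def S_def intro!: cInf_greatest)
  have "X \<tau> \<omega> \<le> d"
  proof (rule ccontr)
    assume "\<not> X \<tau> \<omega> \<le> d"
    moreover have "((\<lambda>t. X t \<omega>) \<longlongrightarrow> X \<tau> \<omega>) (at_right \<tau>)"
      using cad \<tau> by (simp add: cadlag_def)
    ultimately have "\<forall>\<^sub>F s in at_right \<tau>. d < X s \<omega>"
      by (intro order_tendstoD(1)) auto
    then obtain e where e: "\<tau> < e" "\<And>s. \<tau> < s \<Longrightarrow> s < e \<Longrightarrow> d < X s \<omega>"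
      unfolding eventually_at_right_field by blast
    obtain s where s: "s \<in> S" "s < e"
      using e(1) \<open>S \<noteq> {}\<close> bdd unfolding \<tau>_def by (auto simp: cInf_less_iff)
    have "\<tau> \<le> s" unfolding \<tau>_def using s bdd by (intro cInf_lower)
    then show False
      using e(2)[of s] s \<open>\<not> X \<tau> \<omega> \<le> d\<close> by (cases "s = \<tau>") (auto simp: S_def)
  qed
  have int: "set_integrable lborel {0..\<tau>} (\<lambda>s. b (X s \<omega>))"
    and eq: "X \<tau> \<omega> = x + (LBINT s:{0..\<tau>}. b (X s \<omega>)) + Z \<tau>"
    using sol[of \<tau>] \<tau> by (auto simp: ex_eq \<tau>_def)
  have "g * \<tau> = (LBINT s:{0..\<tau>}. g)"
    using \<tau> by (simp add: set_lebesgue_integral_def)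
  also have "\<dots> \<le> (LBINT s:{0..\<tau>}. b (X s \<omega>))"
  proof -
    have below: "g \<le> b (X s \<omega>)" if "0 < s" "s < \<tau>" for s
    proof -
      have "s \<notin> S" using that bdd cInf_lower[of s S] by (auto simp: \<tau>_def)
      then show ?thesis using that by (intro b) (auto simp: S_def)
    qed
    have "AE s in lborel. s \<noteq> 0" "AE s in lborel. s \<noteq> \<tau>"
      by (simp_all add: AE_lborel_singleton)
    then have "AE s in lborel. indicator {0..\<tau>} s *\<^sub>R g \<le> indicator {0..\<tau>} s *\<^sub>R b (X s \<omega>)"
      by eventually_elim (auto split: split_indicator intro!: below)
    moreover have "set_integrable lborel {0..\<tau>} (\<lambda>_. g)"
      by (intro borel_integrable_atLeastAtMost' continuous_on_const)
    ultimately show ?thesis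
      unfolding set_lebesgue_integral_def
      using int by (intro integral_mono_AE) (simp_all only: set_integrable_def)
  qed
  finally have "x - d + g * \<tau> \<le> \<bar>Z \<tau>\<bar>"
    using eq \<open>X \<tau> \<omega> \<le> d\<close> by linarith
  with \<tau> show ?thesis by auto
qed

text \<open>The comparison event depends neither on the solution nor on its starting point, which makes the
final bound uniform in \<open>x\<close>.\<close>

lemma exit_prob_le:
  assumes sol: "local_solution M b L x \<epsilon> d X" and b: "\<And>y. d < y \<Longrightarrow> g \<le> b y"
    and \<epsilon>: "0 < \<epsilon>" and x: "h + d \<le> x" and T: "T \<le> T'"
  shows "exit_prob M d X T
    \<le> outer_measure_of M {\<omega>\<in>space M. \<exists>t\<in>{0..T'}. h / \<epsilon> + g / \<epsilon> * t \<le> \<bar>L t \<omega>\<bar>}"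
proof -
  let ?C = "{\<omega>\<in>space M. \<exists>t\<in>{0..T'}. h / \<epsilon> + g / \<epsilon> * t \<le> \<bar>L t \<omega>\<bar>}"
  obtain N where N: "\<And>\<omega>. \<omega> \<in> space M - N \<Longrightarrow> cadlag (\<lambda>t. X t \<omega>) \<and>
        (\<forall>t\<ge>0. ereal t \<le> exit_time d X \<omega> \<longrightarrow>
           set_integrable lborel {0..t} (\<lambda>s. b (X s \<omega>)) \<and>
           X t \<omega> = x + (LBINT s:{0..t}. b (X s \<omega>)) + \<epsilon> * L t \<omega>)" "N \<in> null_sets M"
    using sol[unfolded local_solution_def, THEN conjunct2] by (rule AE_E3) blast
  have "{\<omega>\<in>space M. exit_time d X \<omega> \<le> ereal T} \<subseteq> N \<union> ?C"
  proof safe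
    fix \<omega> assume \<omega>: "\<omega> \<in> space M" "\<omega> \<notin> N" "exit_time d X \<omega> \<le> ereal T"
    have "\<exists>t\<in>{0..T}. x - d + g * t \<le> \<bar>\<epsilon> * L t \<omega>\<bar>"
      using N(1)[of \<omega>] \<omega> b by (intro exit_forces_noise_above_line[where b=b and X=X]) auto
    then obtain t where t: "t \<in> {0..T}" "x - d + g * t \<le> \<bar>\<epsilon> * L t \<omega>\<bar>" by blast
    then have "h + g * t \<le> \<epsilon> * \<bar>L t \<omega>\<bar>"
      using x \<epsilon> by (simp add: abs_mult)
    then have "h / \<epsilon> + g / \<epsilon> * t \<le> \<bar>L t \<omega>\<bar>"
      using \<epsilon> by (simp add: field_simps)
    then show "\<exists>t\<in>{0..T'}. h / \<epsilon> + g / \<epsilon> * t \<le> \<bar>L t \<omega>\<bar>"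
      using t T by (intro bexI[of _ t]) auto
  qed
  then have "exit_prob M d X T \<le> outer_measure_of M (N \<union> ?C)"
    unfolding exit_prob_def by (rule outer_measure_of_mono)
  also have "\<dots> \<le> outer_measure_of M N + outer_measure_of M ?C"
    by (rule outer_measure_of_Un_le)
  also have "outer_measure_of M N = 0"
    using N by (simp add: null_setsD1 null_setsD2)
  finally show ?thesis by simp
qed

section \<open>Exit probabilities for small noise\<close>

lemma dyadic_bound_of_time_horizon:
  fixes T :: real
  assumes "1 \<le> T"
  obtains N :: nat where "T \<le> 2 ^ N" "2 ^ N \<le> 2 * T" "real N \<le> log 2 T + 1"
proof
  let ?N = "nat \<lceil>log 2 T\<rceil>"
  have 0: "0 \<le> log 2 T" using assms by simp
  then have N: "log 2 T \<le> real ?N" "real ?N \<le> log 2 T + 1" by linarith+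
  then show "real ?N \<le> log 2 T + 1" by simp
  have "T = 2 powr log 2 T" using assms by simp
  also have "\<dots> \<le> 2 powr real ?N" using N by (intro powr_mono) auto
  finally show "T \<le> 2 ^ ?N" by (simp add: powr_realpow)
  have "2 powr real ?N \<le> 2 powr (log 2 T + 1)" using N by (intro powr_mono) auto
  also have "\<dots> = 2 * T" using assms by (simp add: powr_add)
  finally show "2 ^ ?N \<le> 2 * T" by (simp add: powr_realpow)
qed

theorem theorem2:
  fixes M :: "'a measure" and L :: "real \<Rightarrow> 'a \<Rightarrow> real"
    and Bp Bm \<beta>p \<beta>m c \<alpha> :: real
  assumes "0 < Bp" and "0 < Bm" and "\<beta>p \<in> {0<..<1}" and "\<beta>m \<in> {0<..<1}"
    and "0 < c" and "\<alpha> \<in> {0<..<2}"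
    and "symmetric_stable_process M L c \<alpha>"
  shows "\<exists>\<delta> :: real \<Rightarrow> real.
    (\<forall>\<epsilon>\<in>{0<..<1}. \<delta> \<epsilon> \<in> {0<..<1}) \<and>
    mono_on {0<..<1} \<delta> \<and> continuous_on {0<..<1} \<delta> \<and>
    (\<exists>q>0. ((\<lambda>\<epsilon>. ln (\<delta> \<epsilon>) / ln \<epsilon>) \<longlongrightarrow> q) (at_right 0)) \<and>
    (\<delta> \<longlongrightarrow> 0) (at_right 0) \<and>
    (\<forall>X :: real \<Rightarrow> real \<Rightarrow> real \<Rightarrow> 'a \<Rightarrow> real.
       (\<forall>\<epsilon>\<in>{0<..<1}. \<forall>x>\<delta> \<epsilon>.
          local_solution M (drift Bp Bm \<beta>p \<beta>m) L x \<epsilon> (\<delta> \<epsilon>) (X x \<epsilon>)) \<longrightarrow>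
       (\<forall>m :: real \<Rightarrow> real.
          (\<forall>\<epsilon>\<in>{0<..<1}. 0 < m \<epsilon>) \<longrightarrow>
          filterlim m at_top (at_right 0) \<longrightarrow>
          Limsup (at_right 0) (\<lambda>\<epsilon>. ereal (m \<epsilon> * \<epsilon> powr \<alpha>)) < \<infinity> \<longrightarrow>
          ((\<lambda>\<epsilon>. SUP x\<in>{3 * \<delta> \<epsilon>..}. exit_prob M (\<delta> \<epsilon>) (X x \<epsilon>) (m \<epsilon>)) \<longlongrightarrow> 0) (at_right 0)))"
proof -
  have \<alpha>: "0 < \<alpha>" and \<beta>: "0 < \<beta>p" "\<beta>p < 1" using assms by auto
  define q where "q = min 1 \<alpha> / 2"
  have q: "0 < q" "q < 1" using \<alpha> by (auto simp: q_def)
  \<comment> \<open>\<open>\<epsilon> powr (- \<alpha> * \<rho>)\<close> is the growth of \<open>(2 ^ N) powr \<rho>\<close> over horizons of order \<open>\<epsilon> powr - \<alpha>\<close>; \<open>p\<close> is the net power of \<open>\<epsilon>\<close> in the\<close>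
  \<comment> \<open>contribution of the dyadic blocks. Positivity of \<open>p\<close> is the condition \<open>\<beta>p * q < min 1 \<alpha> = 1 - \<rho>\<close>.\<close>
  define \<rho> where "\<rho> = max 0 (1 - \<alpha>)"
  define p where "p = \<alpha> - \<alpha> * \<beta>p * q - \<alpha> * \<rho>"
  have p: "0 < p"
  proof -
    have "\<beta>p * q < q" using \<beta> q by simp
    also have "q < min 1 \<alpha>" using \<alpha> by (auto simp: q_def)
    finally have "0 < 1 - \<rho> - \<beta>p * q" by (auto simp: \<rho>_def)
    then have "0 < \<alpha> * (1 - \<rho> - \<beta>p * q)" using \<alpha> by simp
    then show ?thesis by (simp add: p_def algebra_simps)
  qed
  define \<delta> :: "real \<Rightarrow> real" where "\<delta> \<epsilon> = \<epsilon> powr q" for \<epsilon>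
  have near0: "\<forall>\<^sub>F \<epsilon>::real in at_right 0. \<epsilon> \<in> {0<..<1}"
    by (rule eventually_at_right_real) simp
  have \<delta>_range: "\<forall>\<epsilon>\<in>{0<..<1}. \<delta> \<epsilon> \<in> {0<..<1}"
  proof
    fix \<epsilon> :: real assume "\<epsilon> \<in> {0<..<1}"
    then show "\<delta> \<epsilon> \<in> {0<..<1}"
      using powr_less_mono2[of q \<epsilon> 1] q by (simp add: \<delta>_def)
  qed
  have \<delta>_mono: "mono_on {0<..<1} \<delta>"
    using q by (auto simp: \<delta>_def intro!: mono_onI powr_mono2)
  have \<delta>_cont: "continuous_on {0<..<1} \<delta>"
    unfolding \<delta>_def by (intro continuous_intros) auto
  have \<delta>_order: "((\<lambda>\<epsilon>. ln (\<delta> \<epsilon>) / ln \<epsilon>) \<longlongrightarrow> q) (at_right 0)"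
    by (rule tendsto_eventually, rule eventually_mono[OF near0]) (auto simp: \<delta>_def ln_powr)
  have \<delta>_lim: "(\<delta> \<longlongrightarrow> 0) (at_right 0)"
    unfolding \<delta>_def using q by real_asymp
  obtain K where K: "0 \<le> K" "\<And>T a. 0 < T \<Longrightarrow> 0 < a \<Longrightarrow>
      outer_measure_of M {\<omega>\<in>space M. \<exists>t\<in>{0..T}. a < \<bar>L t \<omega>\<bar>} \<le> ennreal (K * T * a powr - \<alpha>)"
    using symmetric_stable_maximal_inequality[of c \<alpha> M L] assms by auto
  have "((\<lambda>\<epsilon>. SUP x\<in>{3 * \<delta> \<epsilon>..}. exit_prob M (\<delta> \<epsilon>) (X x \<epsilon>) (m \<epsilon>)) \<longlongrightarrow> 0) (at_right 0)"
    if X: "\<forall>\<epsilon>\<in>{0<..<1}. \<forall>x>\<delta> \<epsilon>.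
          local_solution M (drift Bp Bm \<beta>p \<beta>m) L x \<epsilon> (\<delta> \<epsilon>) (X x \<epsilon>)"
      and m: "Limsup (at_right 0) (\<lambda>\<epsilon>. ereal (m \<epsilon> * \<epsilon> powr \<alpha>)) < \<infinity>"
    for X :: "real \<Rightarrow> real \<Rightarrow> real \<Rightarrow> 'a \<Rightarrow> real" and m :: "real \<Rightarrow> real"
  proof -
    obtain C0 :: real where "Limsup (at_right 0) (\<lambda>\<epsilon>. ereal (m \<epsilon> * \<epsilon> powr \<alpha>)) < ereal C0"
      using ereal_dense2[OF m] by auto
    then have C0: "\<forall>\<^sub>F \<epsilon> in at_right 0. m \<epsilon> * \<epsilon> powr \<alpha> < C0"
      by (auto dest: Limsup_lessD)
    define C where "C = max 1 C0"
    have C: "1 \<le> C" by (simp add: C_def)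
    define D where "D = 2 * (Bp / 2) powr - \<alpha> * (2 * C) powr \<rho>"
    \<comment> \<open>The first power comes from times up to 1, the rest from the dyadic blocks, whose number grows like \<open>- ln \<epsilon>\<close>.\<close>
    define R where "R \<epsilon> = K * (\<epsilon> powr (\<alpha> * (1 - q))
        + D * ((log 2 C + 1) * \<epsilon> powr p - \<alpha> / ln 2 * (ln \<epsilon> * \<epsilon> powr p)))" for \<epsilon>
    have "((\<lambda>\<epsilon>::real. \<epsilon> powr (\<alpha> * (1 - q))) \<longlongrightarrow> 0) (at_right 0)"
    proof -
      have "0 < \<alpha> * (1 - q)" using \<alpha> q by simp
      then show ?thesis by real_asymp
    qed
    moreover have "((\<lambda>\<epsilon>::real. \<epsilon> powr p) \<longlongrightarrow> 0) (at_right 0)"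
      using p by real_asymp
    moreover have "((\<lambda>\<epsilon>::real. ln \<epsilon> * \<epsilon> powr p) \<longlongrightarrow> 0) (at_right 0)"
      using p by real_asymp
    ultimately have "(R \<longlongrightarrow> K * (0 + D * ((log 2 C + 1) * 0 - \<alpha> / ln 2 * 0))) (at_right 0)"
      unfolding R_def by (intro tendsto_intros)
    then have "((\<lambda>\<epsilon>. ennreal (R \<epsilon>)) \<longlongrightarrow> ennreal 0) (at_right 0)"
      by (intro tendsto_ennrealI) simp
    then have R: "((\<lambda>\<epsilon>. ennreal (R \<epsilon>)) \<longlongrightarrow> 0) (at_right 0)" by simp
    have bound: "exit_prob M (\<delta> \<epsilon>) (X x \<epsilon>) (m \<epsilon>) \<le> ennreal (R \<epsilon>)"
      if \<epsilon>: "\<epsilon> \<in> {0<..<1}" and m\<epsilon>: "m \<epsilon> * \<epsilon> powr \<alpha> < C0" and x: "3 * \<delta> \<epsilon> \<le> x" for \<epsilon> x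
    proof -
      have \<epsilon>0: "0 < \<epsilon>" "\<epsilon> < 1" and \<delta>0: "0 < \<delta> \<epsilon>" using \<epsilon> \<delta>_range by auto
      \<comment> \<open>\<open>T\<close> dominates the horizon \<open>m \<epsilon>\<close>, and \<open>2 ^ N\<close> is comparable to \<open>T\<close>.\<close>
      define T where "T = C * \<epsilon> powr - \<alpha>"
      have "1 \<le> \<epsilon> powr - \<alpha>" using \<epsilon>0 \<alpha> by (simp add: powr_minus one_le_inverse powr_le1)
      then have T1: "1 \<le> T" using C mult_mono[of 1 C 1 "\<epsilon> powr - \<alpha>"] by (simp add: T_def)
      have "m \<epsilon> * \<epsilon> powr \<alpha> \<le> C" using m\<epsilon> by (simp add: C_def)
      then have mT: "m \<epsilon> \<le> T" using \<epsilon>0 by (simp add: T_def powr_minus field_simps)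
      obtain N :: nat where N: "T \<le> 2 ^ N" "2 ^ N \<le> 2 * T" "real N \<le> log 2 T + 1"
        using dyadic_bound_of_time_horizon[OF T1] .
      \<comment> \<open>A lower bound for the drift above level \<open>\<delta> \<epsilon>\<close>.\<close>
      define g where "g = Bp * \<delta> \<epsilon> powr \<beta>p"
      have g: "0 < g" using assms(1) \<delta>0 by (simp add: g_def)
      have drift: "g \<le> drift Bp Bm \<beta>p \<beta>m y" if "\<delta> \<epsilon> < y" for y
        using that \<delta>0 \<beta> assms(1) by (auto simp: g_def drift_def intro!: mult_left_mono powr_mono2)
      have "exit_prob M (\<delta> \<epsilon>) (X x \<epsilon>) (m \<epsilon>)
          \<le> outer_measure_of M {\<omega>\<in>space M. \<exists>t\<in>{0..2 ^ N}. 2 * \<delta> \<epsilon> / \<epsilon> + g / \<epsilon> * t \<le> \<bar>L t \<omega>\<bar>}"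
        using X \<epsilon> x \<delta>0 drift mT N(1)
        by (intro exit_prob_le[where b="drift Bp Bm \<beta>p \<beta>m" and x=x]) auto
      also have "\<dots> \<le> ennreal (K * ((2 * \<delta> \<epsilon> / \<epsilon> / 2) powr - \<alpha>
          + 2 * (g / \<epsilon> / 2) powr - \<alpha> * real N * (2 ^ N) powr max 0 (1 - \<alpha>)))"
        using \<epsilon>0 \<delta>0 g by (intro linear_boundary_crossing_bound K) auto
      also have "\<dots> \<le> ennreal (R \<epsilon>)"
      proof (rule ennreal_leI)
        have 1: "(2 * \<delta> \<epsilon> / \<epsilon> / 2) powr - \<alpha> = \<epsilon> powr (\<alpha> * (1 - q))"
        proof -
          have "2 * \<delta> \<epsilon> / \<epsilon> / 2 = \<epsilon> powr (q - 1)" using \<epsilon>0 by (simp add: \<delta>_def powr_diff)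
          then show ?thesis by (simp add: powr_powr algebra_simps)
        qed
        have 2: "(g / \<epsilon> / 2) powr - \<alpha> = (Bp / 2) powr - \<alpha> * \<epsilon> powr (\<alpha> - \<alpha> * \<beta>p * q)"
        proof -
          have "g / \<epsilon> / 2 = Bp / 2 * \<epsilon> powr (q * \<beta>p - 1)"
            using \<epsilon>0 by (simp add: g_def \<delta>_def powr_diff powr_powr)
          moreover have "(q * \<beta>p - 1) * - \<alpha> = \<alpha> - \<alpha> * \<beta>p * q"
            by (simp add: algebra_simps)
          ultimately show ?thesis by (simp only: powr_mult powr_powr)
        qed
        have 3: "(2 ^ N) powr \<rho> \<le> (2 * C) powr \<rho> * \<epsilon> powr (- \<alpha> * \<rho>)"
        proof -
          have "(2 ^ N) powr \<rho> \<le> (2 * T) powr \<rho>"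
            using N(2) by (intro powr_mono2) (auto simp: \<rho>_def)
          also have "2 * T = (2 * C) * \<epsilon> powr - \<alpha>" by (simp add: T_def)
          also have "\<dots> powr \<rho> = (2 * C) powr \<rho> * \<epsilon> powr (- \<alpha> * \<rho>)"
            using C by (simp only: powr_mult powr_powr)
          finally show ?thesis .
        qed
        \<comment> \<open>The number of blocks is of logarithmic order in \<open>\<epsilon>\<close>.\<close>
        have 4: "real N \<le> log 2 C + 1 - \<alpha> / ln 2 * ln \<epsilon>"
        proof -
          have "log 2 T = log 2 C - \<alpha> / ln 2 * ln \<epsilon>"
            using C \<epsilon>0 by (simp add: T_def log_def ln_mult ln_powr diff_divide_distrib)
          with N(3) show ?thesis by simp
        qed
        have "2 * (g / \<epsilon> / 2) powr - \<alpha> * real N * (2 ^ N) powr \<rho>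
            \<le> 2 * (g / \<epsilon> / 2) powr - \<alpha> * (log 2 C + 1 - \<alpha> / ln 2 * ln \<epsilon>)
              * ((2 * C) powr \<rho> * \<epsilon> powr (- \<alpha> * \<rho>))"
          using 4 of_nat_0_le_iff[of N, where 'a=real]
          by (intro mult_mono 3) (auto intro: order_trans)
        also have "\<dots> = D * ((log 2 C + 1 - \<alpha> / ln 2 * ln \<epsilon>)
            * (\<epsilon> powr (\<alpha> - \<alpha> * \<beta>p * q) * \<epsilon> powr (- \<alpha> * \<rho>)))"
          unfolding 2 D_def by (simp only: mult_ac)
        also have "\<epsilon> powr (\<alpha> - \<alpha> * \<beta>p * q) * \<epsilon> powr (- \<alpha> * \<rho>) = \<epsilon> powr p"
          by (simp add: p_def powr_add[symmetric])
        finally show "K * ((2 * \<delta> \<epsilon> / \<epsilon> / 2) powr - \<alpha>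
          + 2 * (g / \<epsilon> / 2) powr - \<alpha> * real N * (2 ^ N) powr max 0 (1 - \<alpha>)) \<le> R \<epsilon>"
          unfolding 1 R_def \<rho>_def[symmetric] using K(1)
          by (intro mult_left_mono) (auto simp: algebra_simps)
      qed
      finally show ?thesis .
    qed
    have "\<forall>\<^sub>F \<epsilon> in at_right 0.
        (SUP x\<in>{3 * \<delta> \<epsilon>..}. exit_prob M (\<delta> \<epsilon>) (X x \<epsilon>) (m \<epsilon>)) \<le> ennreal (R \<epsilon>)"
      using near0 C0 by eventually_elim (auto intro!: SUP_least bound)
    then show ?thesis
      by (intro tendsto_sandwich[OF _ _ tendsto_const R]) auto
  qed
  with q(1) \<delta>_range \<delta>_mono \<delta>_cont \<delta>_order \<delta>_lim show ?thesis
    by (intro exI[of _ \<delta>]) auto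
qed

end
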